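(* For all $\sigma\in(0,\infty)$, $$B(\mathcal{F}_\sigma)=1,$$ that is, $\sup_{G\in\mathcal{F}_\sigma}B(G)=1$.
   Context: For $\sigma\in(0,\infty)$, $\mathcal{F}_\sigma$ is the collection of probability distributions on $\mathbb{R}$ with mean zero, variance $\sigma^2$ and finite absolute third moment. Zero bias distribution: for a random variable $X$ with mean zero and finite nonzero variance $\sigma^2$, there is a unique distribution for a random variable $X^*$ such that $\sigma^2E f'(X^* )=E[Xf(X)]$ for all absolutely continuous functions $f$ for which these expectations exist; it is called the $X$-zero bias distribution. It is absolutely continuous; if $X$ has distribution $G$, then $X^*$ has distribution function $G^*(x)=\sigma^{-2}E[X(X-x)\mathbf{1}(X\le x)]$ and density $g^*(x)=\sigma^{-2}E[X\mathbf{1}(X>x)]$. For distribution functions $F,G$, $\|F-G\|_1=\int_{-\infty}^\infty|F(x)-G(x)|\,dx$. For $X$ with distribution $G$ having mean zero, variance $\sigma^2\in(0,\infty)$ and finite absolute third moment, $$B(G)=\frac{2\sigma^2\|G^*-G\|_1}{E|X|^3},$$ and for a collection $\mathcal{F}$ of such distributions, $B(\mathcal{F})=\sup_{G\in\mathcal{F}}B(G)$. *)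

theory Defs
  imports "HOL-Probability.Probability"
begin

definition abs_continuous_on_interval :: "real \<Rightarrow> real \<Rightarrow> (real \<Rightarrow> real) \<Rightarrow> bool" where
  "abs_continuous_on_interval a b f \<longleftrightarrow>
     (\<forall>\<epsilon>>0. \<exists>\<delta>>0. \<forall>P :: (real \<times> real) set.
        finite P \<and> (\<forall>(x, y)\<in>P. a \<le> x \<and> x \<le> y \<and> y \<le> b) \<and>
        pairwise (\<lambda>p q. disjnt {fst p<..<snd p} {fst q<..<snd q}) P \<and>
        (\<Sum>(x, y)\<in>P. y - x) < \<delta> \<longrightarrow>
        (\<Sum>(x, y)\<in>P. \<bar>f y - f x\<bar>) < \<epsilon>)"

text \<open>As usual for functions on the whole real line, absolute continuity is meant locally, that
  is, on every compact interval; this includes every function of the form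
  \<open>f(x) = c + \<integral>\<^sub>0\<^sup>x h\<close> with \<open>h\<close> locally integrable.\<close>

definition abs_continuous_fun :: "(real \<Rightarrow> real) \<Rightarrow> bool" where
  "abs_continuous_fun f \<longleftrightarrow> (\<forall>a b. a \<le> b \<longrightarrow> abs_continuous_on_interval a b f)"

text \<open>A distribution is a Borel probability measure \<open>G\<close> on the reals, namely the law of \<open>X\<close>.\<close>

definition dist_mean :: "real measure \<Rightarrow> real" where
  "dist_mean G = (\<integral>x. x \<partial>G)"

definition dist_variance :: "real measure \<Rightarrow> real" where
  "dist_variance G = (\<integral>x. (x - dist_mean G)\<^sup>2 \<partial>G)"

definition abs_third_moment :: "real measure \<Rightarrow> real" where
  "abs_third_moment G = (\<integral>x. \<bar>x\<bar> ^ 3 \<partial>G)"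

text \<open>\<open>N\<close> is an \<open>X\<close>-zero bias distribution, where \<open>X\<close> has law \<open>G\<close>. An absolutely continuous \<open>f\<close> is
  differentiable only almost everywhere, so its derivative is represented by any function \<open>f'\<close>
  agreeing with it Lebesgue-almost everywhere; the integrability assumptions say that the two
  expectations exist. The identity for every version \<open>f'\<close> forces \<open>N\<close> to have a Lebesgue density.\<close>

definition is_zero_bias :: "real measure \<Rightarrow> real measure \<Rightarrow> bool" where
  "is_zero_bias G N \<longleftrightarrow> real_distribution N \<and>
     (\<forall>f f'. abs_continuous_fun f \<longrightarrow>
        (AE x in lborel. (f has_real_derivative f' x) (at x)) \<longrightarrow>
        integrable N f' \<longrightarrow> integrable G (\<lambda>x. x * f x) \<longrightarrow>
        dist_variance G * (\<integral>x. f' x \<partial>N) = (\<integral>x. x * f x \<partial>G))"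

text \<open>Meaningful for \<open>G\<close> with mean zero and finite nonzero variance, where existence and
  uniqueness hold.\<close>

definition zero_bias :: "real measure \<Rightarrow> real measure" where
  "zero_bias G = (THE N. is_zero_bias G N)"

definition L1_dist :: "(real \<Rightarrow> real) \<Rightarrow> (real \<Rightarrow> real) \<Rightarrow> ennreal" where
  "L1_dist F G = (\<integral>\<^sup>+x. ennreal \<bar>F x - G x\<bar> \<partial>lborel)"

definition B_functional :: "real measure \<Rightarrow> ennreal" where
  "B_functional G =
     ennreal (2 * dist_variance G) * L1_dist (cdf (zero_bias G)) (cdf G)
       / ennreal (abs_third_moment G)"

definition B_collection :: "real measure set \<Rightarrow> ennreal" where
  "B_collection \<F> = (SUP G\<in>\<F>. B_functional G)"

text \<open>The first two integrability conditions follow from the third; they are listed so that mean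
  and variance are visibly genuine integrals rather than the default value \<open>0\<close>.\<close>

definition F_class :: "real \<Rightarrow> real measure set" where
  "F_class \<sigma> = {G. real_distribution G \<and>
     integrable G (\<lambda>x. x) \<and> integrable G (\<lambda>x. x\<^sup>2) \<and> integrable G (\<lambda>x. \<bar>x\<bar> ^ 3) \<and>
     dist_mean G = 0 \<and> dist_variance G = \<sigma>\<^sup>2}"

end

theory Submission
  imports Defs
begin

text \<open>
  Let \<open>X\<close>, \<open>Y\<close> be independent with law \<open>G\<close>. Testing the zero bias identity with \<open>min(\<cdot>, t)\<close> gives
  \<open>\<sigma>\<^sup>2 G\<^sup>*(t) = E[X min(X, t)]\<close>, and symmetrising with the help of \<open>E X = E Y = 0\<close> yields
  \<open>2 \<sigma>\<^sup>2 (G\<^sup>*(t) - G(t)) = E[(X - Y) (X + Y - t) (1(X \<le> t) - 1(Y \<le> t))]\<close>.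
  Taking absolute values inside and integrating over \<open>t\<close> turns the right-hand side into
  \<open>E[(X - Y) (X|X| - Y|Y|)] / 2\<close>, whose mixed terms vanish by independence, leaving \<open>E|X|\<^sup>3\<close>.
  Hence \<open>B(G) \<le> 1\<close>, with equality for the uniform law on \<open>{\<sigma>, -\<sigma>}\<close>.

  The zero bias law exists as the second marginal of the measure with density
  \<open>\<sigma>\<^sup>-\<^sup>2 |x| 1(t between 0 and x)\<close> with respect to \<open>G(dx) dt\<close>: integrating \<open>f'(t)\<close> over \<open>t\<close> gives
  \<open>\<sigma>\<^sup>-\<^sup>2 x (f(x) - f(0))\<close>, by the fundamental theorem of calculus for absolutely continuous \<open>f\<close>.
\<close>

section \<open>Fundamental theorem of calculus for absolutely continuous functions\<close>

text \<open>A gauge for the Henstock--Kurzweil integral is chosen so that the intervals tagged in the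
  exceptional null set stay inside an open set of small measure; absolute continuity bounds their
  contribution, and the derivative controls all other intervals.\<close>

lemma has_integral_abs_continuous:
  fixes f f' :: "real \<Rightarrow> real"
  assumes "a \<le> b" and ac: "abs_continuous_on_interval a b f"
    and der: "AE x in lborel. (f has_real_derivative f' x) (at x)"
  shows "(f' has_integral (f b - f a)) {a..b}"
proof -
  obtain N where N: "{x. \<not> (f has_real_derivative f' x) (at x)} \<subseteq> N" "emeasure lborel N = 0"
      "N \<in> sets borel"
    using der by (auto elim!: AE_E)
  \<comment> \<open>Setting \<open>g\<close> to zero on \<open>N\<close> reduces the terms tagged in
    \<open>N\<close> to increments of \<open>f\<close>; at the end \<open>g\<close> is exchanged for
    \<open>f'\<close> on a negligible set.\<close>
  define g where "g x = (if x \<in> N then 0 else f' x)" for x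
  have "(g has_integral (f b - f a)) {a..b}"
    unfolding has_integral_real
  proof (intro allI impI)
    fix e :: real assume "e > 0"
    \<comment> \<open>One half of \<open>e\<close> is reserved for the intervals tagged outside
      \<open>N\<close>, of total length at most \<open>b - a\<close>; the summand 1 keeps the
      denominator positive when \<open>a = b\<close>.\<close>
    define \<eta> where "\<eta> = e / (2 * (b - a + 1))"
    have "\<eta> > 0" using \<open>e > 0\<close> \<open>a \<le> b\<close> by (simp add: \<eta>_def)
    have \<eta>: "\<eta> * (b - a) \<le> e / 2"
      using \<open>e > 0\<close> \<open>a \<le> b\<close> by (simp add: \<eta>_def field_simps)
    obtain \<delta> where "\<delta> > 0" and \<delta>: "\<And>P :: (real \<times> real) set. finite P \<Longrightarrow>
        (\<forall>(x, y)\<in>P. a \<le> x \<and> x \<le> y \<and> y \<le> b) \<Longrightarrow>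
        pairwise (\<lambda>p q. disjnt {fst p<..<snd p} {fst q<..<snd q}) P \<Longrightarrow>
        (\<Sum>(x, y)\<in>P. y - x) < \<delta> \<Longrightarrow> (\<Sum>(x, y)\<in>P. \<bar>f y - f x\<bar>) < e / 2"
      using ac \<open>e > 0\<close> unfolding abs_continuous_on_interval_def
      by (metis (no_types, lifting) half_gt_zero)
    obtain U where U: "open U" "N \<subseteq> U" "emeasure lborel (U - N) < \<delta>"
      using outer_regular_lborel[OF N(3) \<open>\<delta> > 0\<close>] .
    have [measurable]: "U \<in> sets borel" "N \<in> sets borel" using U N by auto
    have "emeasure lborel U = emeasure lborel (U - N)"
      using N(2,3) by (intro emeasure_Diff_null_set[symmetric]) (auto simp: null_sets_def)
    with U have emU: "emeasure lborel U < \<delta>" by simp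
    then have fin_U: "emeasure lborel U < \<infinity>"
      by (rule order.strict_trans) simp
    have mU: "measure lborel U < \<delta>"
      using emU fin_U by (simp add: measure_def enn2real_less_iff)
    have fmU: "U \<in> fmeasurable lborel"
      using fin_U by (simp add: fmeasurable_def)
    have "\<exists>d>0. if x \<in> N then ball x d \<subseteq> U
        else \<forall>y. \<bar>y - x\<bar> < d \<longrightarrow> \<bar>f y - f x - (y - x) * f' x\<bar> \<le> \<eta> * \<bar>y - x\<bar>" for x
    proof (cases "x \<in> N")
      case True
      then show ?thesis using U(1,2) by (simp add: open_contains_ball subset_iff)
    next
      case False
      then have "(f has_derivative (\<lambda>h. f' x * h)) (at x)"
        using N(1) by (auto simp: has_field_derivative_def)
      then show ?thesis using False \<open>\<eta> > 0\<close>
        by (auto simp: has_derivative_at_alt mult.commute)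
    qed
    then obtain d where d: "\<And>x. d x > 0" "\<And>x. x \<in> N \<Longrightarrow> ball x (d x) \<subseteq> U"
      "\<And>x y. x \<notin> N \<Longrightarrow> \<bar>y - x\<bar> < d x \<Longrightarrow> \<bar>f y - f x - (y - x) * f' x\<bar> \<le> \<eta> * \<bar>y - x\<bar>"
      by metis
    show "\<exists>\<gamma>. gauge \<gamma> \<and> (\<forall>\<D>. \<D> tagged_division_of {a..b} \<and> \<gamma> fine \<D> \<longrightarrow>
        norm ((\<Sum>(x, k)\<in>\<D>. measure lborel k *\<^sub>R g x) - (f b - f a)) < e)"
    proof (intro exI conjI allI impI)
      show "gauge (\<lambda>x. ball x (d x))"
        using d(1) gauge_ball_dependent by blast
    next
      fix p assume "p tagged_division_of {a..b} \<and> (\<lambda>x. ball x (d x)) fine p"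
      then have ptag: "p tagged_division_of {a..b}" and fine: "(\<lambda>x. ball x (d x)) fine p" by auto
      have fin: "finite p" using ptag by blast
      have ba: "b - a = (\<Sum>(x,K)\<in>p. Sup K - Inf K)" "f b - f a = (\<Sum>(x,K)\<in>p. f(Sup K) - f(Inf K))"
        using additive_tagged_division_1[where f= "\<lambda>x. x"] additive_tagged_division_1[where f= f]
            \<open>a \<le> b\<close> ptag by auto
      have K: "\<exists>u v. K = {u..v} \<and> Inf K = u \<and> Sup K = v \<and> a \<le> u \<and> u \<le> x \<and> x \<le> v \<and> v \<le> b
          \<and> K \<subseteq> ball x (d x)" if xK: "(x, K) \<in> p" for x K
      proof -
        have "x \<in> K" "K \<subseteq> {a..b}" using ptag xK by blast+
        moreover obtain u v where "K = cbox u v"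
          using tagged_division_ofD(4)[OF ptag xK] by blast
        ultimately show ?thesis using fine that by (auto simp: fine_def)
      qed
      have disj: "interior K1 \<inter> interior K2 = {}"
        if "(x1, K1) \<in> p" "(x2, K2) \<in> p" "(x1, K1) \<noteq> (x2, K2)" for x1 K1 x2 K2
        using tagged_division_ofD(5)[OF ptag that] .
      define q where "q = {(x, K) \<in> p. x \<in> N}"
      have qp: "q \<subseteq> p" and finq: "finite q" using fin by (auto simp: q_def intro: finite_subset)
      define \<phi> where "\<phi> = (\<lambda>(x::real, K::real set). (Inf K, Sup K))"
      \<comment> \<open>Absolute continuity speaks of sets of endpoint pairs, so no two tagged
        intervals may collapse to one pair: nondegenerate ones would share interior points, and a
        degenerate one has its only point as tag.\<close>
      have inj: "inj_on \<phi> q"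
      proof (rule inj_onI, clarsimp simp: \<phi>_def)
        fix x1 K1 x2 K2 assume A: "(x1, K1) \<in> q" "(x2, K2) \<in> q" "Inf K1 = Inf K2" "Sup K1 = Sup K2"
        have p: "(x1, K1) \<in> p" "(x2, K2) \<in> p" using A qp by auto
        obtain u v where uv: "K1 = {u..v}" "u \<le> x1" "x1 \<le> v" "Inf K1 = u" "Sup K1 = v"
          using K[OF p(1)] by blast
        have uv2: "K2 = {u..v}" "u \<le> x2" "x2 \<le> v" using K[OF p(2)] A uv by auto
        show "x1 = x2 \<and> K1 = K2"
        proof (cases "u < v")
          case True
          then show ?thesis using disj[OF p] uv(1) uv2(1)
            by (auto simp: interior_atLeastAtMost_real)
        next
          case False then show ?thesis using uv uv2 by auto
        qed
      qed
      have "(\<Sum>(x, y)\<in>\<phi> ` q. \<bar>f y - f x\<bar>) < e / 2"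
      proof (rule \<delta>)
        show "finite (\<phi> ` q)" using finq by simp
        show "\<forall>(x, y)\<in>\<phi> ` q. a \<le> x \<and> x \<le> y \<and> y \<le> b"
          using K qp by (fastforce simp: \<phi>_def)
        have dj: "disjnt {fst (\<phi> r)<..<snd (\<phi> r)} {fst (\<phi> s)<..<snd (\<phi> s)}"
          if rs: "r \<in> q" "s \<in> q" "r \<noteq> s" for r s
        proof -
          obtain x1 K1 x2 K2 where e: "r = (x1, K1)" "s = (x2, K2)" by (metis surj_pair)
          have p: "(x1, K1) \<in> p" "(x2, K2) \<in> p" using rs e qp by auto
          have "interior K1 = {Inf K1<..<Sup K1}" "interior K2 = {Inf K2<..<Sup K2}"
            using K[OF p(1)] K[OF p(2)] by (metis interior_atLeastAtMost_real)+
          then show ?thesis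
            using disj[OF p] rs e by (simp add: \<phi>_def disjnt_def)
        qed
        then show "pairwise (\<lambda>p q. disjnt {fst p<..<snd p} {fst q<..<snd q}) (\<phi> ` q)"
          by (fastforce simp: pairwise_def)
        \<comment> \<open>The open intervals are disjoint and lie in \<open>U\<close>, so their
          lengths add up to at most the measure of \<open>U\<close>.\<close>
        have "(\<Sum>(x, y)\<in>\<phi> ` q. y - x) = (\<Sum>r\<in>q. measure lborel {fst (\<phi> r)<..<snd (\<phi> r)})"
          unfolding sum.reindex[OF inj] o_def
          using K qp by (intro sum.cong refl) (fastforce simp: \<phi>_def)
        also have "\<dots> = measure lborel (\<Union>r\<in>q. {fst (\<phi> r)<..<snd (\<phi> r)})"
          using finq dj fmeasurable_box[where 'a = real]
          by (intro measure_UNION'[symmetric]) (auto simp: pairwise_def)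
        also have "\<dots> \<le> measure lborel U"
        proof (rule measure_mono_fmeasurable[OF _ _ fmU])
          show "(\<Union>r\<in>q. {fst (\<phi> r)<..<snd (\<phi> r)}) \<subseteq> U"
          proof clarify
            fix t x K' assume "(x, K') \<in> q" "t \<in> {fst (\<phi> (x, K'))<..<snd (\<phi> (x, K'))}"
            moreover have "(x, K') \<in> p" "x \<in> N" using \<open>(x, K') \<in> q\<close> by (auto simp: q_def)
            ultimately have "Inf K' < t" "t < Sup K'" "K' \<subseteq> U"
              using K[of x K'] d(2)[of x] by (auto simp: \<phi>_def)
            moreover obtain u v where "K' = {u..v}" "Inf K' = u" "Sup K' = v"
              using K[OF \<open>(x, K') \<in> p\<close>] by blast
            ultimately show "t \<in> U" by (metis atLeastAtMost_iff less_imp_le subsetD)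
          qed
          show "(\<Union>r\<in>q. {fst (\<phi> r)<..<snd (\<phi> r)}) \<in> sets lborel"
            using finq by auto
        qed
        finally show "(\<Sum>(x, y)\<in>\<phi> ` q. y - x) < \<delta>" using mU by simp
      qed
      then have bad: "(\<Sum>(x, K)\<in>q. \<bar>f (Sup K) - f (Inf K)\<bar>) < e / 2"
        unfolding sum.reindex[OF inj] by (simp add: \<phi>_def o_def split_def)
      \<comment> \<open>The tag \<open>x\<close> splits the interval, and the derivative estimates
        at its two endpoints add up because \<open>(x - u) + (v - x) = v - u\<close>.\<close>
      have good: "\<bar>measure lborel K * g x - (f (Sup K) - f (Inf K))\<bar> \<le> \<eta> * (Sup K - Inf K)"
        if xK: "(x, K) \<in> p - q" for x K
      proof -
        obtain u v where uv: "K = {u..v}" "Inf K = u" "Sup K = v" "u \<le> x" "x \<le> v"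
            "K \<subseteq> ball x (d x)"
          using K[of x K] xK by blast
        have "x \<notin> N" using xK by (auto simp: q_def)
        have "u \<in> K" "v \<in> K" using uv by auto
        then have "u \<in> ball x (d x)" "v \<in> ball x (d x)" using uv(6) by blast+
        then have "\<bar>f u - f x - (u - x) * f' x\<bar> \<le> \<eta> * (x - u)"
            "\<bar>f v - f x - (v - x) * f' x\<bar> \<le> \<eta> * (v - x)"
          using d(3)[OF \<open>x \<notin> N\<close>, of u] d(3)[OF \<open>x \<notin> N\<close>, of v] uv by (auto simp: dist_real_def)
        then have "\<bar>(v - u) * f' x - (f v - f u)\<bar> \<le> \<eta> * (v - u)"
          by (auto simp: algebra_simps abs_le_iff)
        then show ?thesis using uv \<open>x \<notin> N\<close> by (simp add: g_def)
      qed
      have "\<bar>\<Sum>(x, K)\<in>p. measure lborel K * g x - (f (Sup K) - f (Inf K))\<bar>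
          \<le> (\<Sum>(x, K)\<in>p. \<bar>measure lborel K * g x - (f (Sup K) - f (Inf K))\<bar>)"
        by (rule order_trans[OF sum_abs]) (simp add: split_def)
      also have "\<dots> = (\<Sum>(x, K)\<in>p - q. \<bar>measure lborel K * g x - (f (Sup K) - f (Inf K))\<bar>)
          + (\<Sum>(x, K)\<in>q. \<bar>measure lborel K * g x - (f (Sup K) - f (Inf K))\<bar>)"
        by (rule sum.subset_diff[OF qp fin])
      also have "(\<Sum>(x, K)\<in>q. \<bar>measure lborel K * g x - (f (Sup K) - f (Inf K))\<bar>)
          = (\<Sum>(x, K)\<in>q. \<bar>f (Sup K) - f (Inf K)\<bar>)"
        by (intro sum.cong) (auto simp: q_def g_def)
      also have "(\<Sum>(x, K)\<in>p - q. \<bar>measure lborel K * g x - (f (Sup K) - f (Inf K))\<bar>)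
          \<le> (\<Sum>(x, K)\<in>p - q. \<eta> * (Sup K - Inf K))"
        using good by (intro sum_mono) auto
      also have "\<dots> \<le> (\<Sum>(x, K)\<in>p. \<eta> * (Sup K - Inf K))"
        using fin K \<open>\<eta> > 0\<close> by (intro sum_mono2) fastforce+
      also have "\<dots> = \<eta> * (b - a)"
        by (simp add: ba sum_distrib_left split_def)
      also have "\<dots> \<le> e / 2" by fact
      finally show "norm ((\<Sum>(x, k)\<in>p. measure lborel k *\<^sub>R g x) - (f b - f a)) < e"
        using bad by (simp add: ba(2) split_def sum_subtractf)
    qed
  qed
  moreover have "negligible N"
    using N by (auto simp: negligible_iff_null_sets null_sets_def)
  ultimately show ?thesis
    by (rule has_integral_spike[rotated 2]) (auto simp: g_def)
qed

lemma abs_continuous_fun_Lipschitz: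
  assumes "\<And>x y. x \<le> y \<Longrightarrow> \<bar>f y - f x\<bar> \<le> y - x"
  shows "abs_continuous_fun f"
  unfolding abs_continuous_fun_def abs_continuous_on_interval_def
proof (intro allI impI)
  fix a b \<epsilon> :: real assume "\<epsilon> > 0"
  have "(\<Sum>(x, y)\<in>P. \<bar>f y - f x\<bar>) \<le> (\<Sum>(x, y)\<in>P. y - x)"
    if "\<forall>(x, y)\<in>P. a \<le> x \<and> x \<le> y \<and> y \<le> b" for P
    using assms that by (intro sum_mono) auto
  then show "\<exists>\<delta>>0. \<forall>P. finite P \<and> (\<forall>(x, y)\<in>P. a \<le> x \<and> x \<le> y \<and> y \<le> b) \<and>
        pairwise (\<lambda>p q. disjnt {fst p<..<snd p} {fst q<..<snd q}) P \<and>
        (\<Sum>(x, y)\<in>P. y - x) < \<delta> \<longrightarrow> (\<Sum>(x, y)\<in>P. \<bar>f y - f x\<bar>) < \<epsilon>"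
    using \<open>\<epsilon> > 0\<close> by (meson order.strict_trans1)
qed

section \<open>Zero bias distribution: uniqueness, existence and distribution function\<close>

locale centered_distribution = real_distribution G for G +
  assumes integrable_id: "integrable G (\<lambda>x. x)"
    and integrable_square: "integrable G (\<lambda>x. x\<^sup>2)"
    and mean_zero: "(\<integral>x. x \<partial>G) = 0"
    and second_moment_pos: "0 < (\<integral>x. x\<^sup>2 \<partial>G)"
begin

lemma dist_variance_eq: "dist_variance G = (\<integral>x. x\<^sup>2 \<partial>G)"
  by (simp add: dist_variance_def dist_mean_def mean_zero)

lemma integrable_mult_min: "integrable G (\<lambda>x. x * min x t)"
proof (rule Bochner_Integration.integrable_bound)
  show "integrable G (\<lambda>x. x\<^sup>2 + \<bar>t\<bar> * \<bar>x\<bar>)"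
    using integrable_id integrable_square by auto
  have "\<bar>x * min x t\<bar> \<le> x\<^sup>2 + \<bar>t\<bar> * \<bar>x\<bar>" for x
    by (auto simp: min_def abs_mult power2_eq_square)
  then show "AE x in G. norm (x * min x t) \<le> norm (x\<^sup>2 + \<bar>t\<bar> * \<bar>x\<bar>)"
    by (auto intro: order.trans)
qed auto

text \<open>The test function \<open>min x t\<close> has derivative \<open>indicator {..t} x\<close>
  except at \<open>t\<close>, so the zero bias identity evaluates the distribution function of
  \<open>N\<close> at \<open>t\<close>.\<close>

lemma cdf_is_zero_bias:
  assumes "is_zero_bias G N"
  shows "(\<integral>x. x\<^sup>2 \<partial>G) * cdf N t = (\<integral>x. x * min x t \<partial>G)"
proof -
  interpret N: real_distribution N using assms by (simp add: is_zero_bias_def)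
  have "abs_continuous_fun (\<lambda>x. min x t)"
    by (rule abs_continuous_fun_Lipschitz) auto
  moreover have "AE x in lborel. ((\<lambda>x. min x t) has_real_derivative indicator {..t} x) (at x)"
  proof -
    have "((\<lambda>x. min x t) has_real_derivative indicator {..t} x) (at x)" if "x \<noteq> t" for x
    proof (cases "x < t")
      case True
      have "((\<lambda>x. x) has_real_derivative 1) (at x)" by simp
      then have "((\<lambda>x. min x t) has_real_derivative 1) (at x)"
        by (rule has_field_derivative_transform_within[where d = "t - x"]) (use True in \<open>auto simp: dist_real_def\<close>)
      then show ?thesis using True by simp
    next
      case False
      have "((\<lambda>x. t) has_real_derivative 0) (at x)" by simp
      then have "((\<lambda>x. min x t) has_real_derivative 0) (at x)"
        by (rule has_field_derivative_transform_within[where d = "x - t"]) (use False that in \<open>auto simp: dist_real_def\<close>)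
      then show ?thesis using False that by simp
    qed
    then show ?thesis using AE_lborel_singleton[of t] by (auto elim: eventually_mono)
  qed
  moreover have "integrable N (indicator {..t} :: real \<Rightarrow> real)"
    by (intro integrable_real_indicator) (auto simp: N.emeasure_finite less_top[symmetric])
  ultimately have "dist_variance G * (\<integral>x. indicator {..t} x \<partial>N) = (\<integral>x. x * min x t \<partial>G)"
    using assms integrable_mult_min unfolding is_zero_bias_def by blast
  then show ?thesis by (simp add: dist_variance_eq cdf_def)
qed

lemma is_zero_bias_unique:
  assumes "is_zero_bias G N" "is_zero_bias G N'"
  shows "N = N'"
proof (rule cdf_unique)
  show "cdf N = cdf N'"
    using cdf_is_zero_bias[OF assms(1)] cdf_is_zero_bias[OF assms(2)] second_moment_pos
    by (intro ext) (metis mult_cancel_left less_irrefl)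
qed (use assms in \<open>auto simp: is_zero_bias_def\<close>)

lemma is_zero_bias_exists: "\<exists>N. is_zero_bias G N"
proof -
  define s where "s = (\<integral>x. x\<^sup>2 \<partial>G)"
  have "s > 0" using second_moment_pos by (simp add: s_def)
  \<comment> \<open>\<open>K x\<close> spreads the mass \<open>x\<^sup>2 / s\<close> evenly between
    0 and \<open>x\<close>; as \<open>s\<close> is the second moment, the total mass over
    \<open>G\<close> is 1. The conditional form suits measurability, the form \<open>K_ind\<close>
    the integrals.\<close>
  define K :: "real \<Rightarrow> real \<Rightarrow> real"
    where "K x t = (if min 0 x \<le> t \<and> t \<le> max 0 x then \<bar>x\<bar> / s else 0)" for x t
  have K_ind: "K x t = \<bar>x\<bar> / s * indicator {min 0 x..max 0 x} t" for x t
    by (auto simp: K_def indicator_def)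
  have K_nn: "K x t \<ge> 0" for x t using \<open>s > 0\<close> by (simp add: K_def)
  have [measurable]: "(\<lambda>p. K (fst p) (snd p)) \<in> borel_measurable (G \<Otimes>\<^sub>M lborel)"
    unfolding K_def by measurable
  interpret P: pair_sigma_finite G lborel ..
  define Q where "Q = density (G \<Otimes>\<^sub>M lborel) (\<lambda>p. ennreal (K (fst p) (snd p)))"
  define N where "N = distr Q borel snd"
  have snd_meas: "snd \<in> Q \<rightarrow>\<^sub>M borel"
    by (simp add: Q_def)
  have int_K: "(\<integral>\<^sup>+t. ennreal (K x t) \<partial>lborel) = ennreal (x\<^sup>2 / s)" for x
  proof -
    have "(\<integral>\<^sup>+t. ennreal (K x t) \<partial>lborel)
        = (\<integral>\<^sup>+t. ennreal (\<bar>x\<bar> / s) * indicator {min 0 x..max 0 x} t \<partial>lborel)"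
      unfolding K_ind by (intro nn_integral_cong) (auto simp: indicator_def)
    also have "\<dots> = ennreal (\<bar>x\<bar> / s) * ennreal (max 0 x - min 0 x)"
      by (subst nn_integral_cmult_indicator) auto
    also have "\<dots> = ennreal (x\<^sup>2 / s)"
      using \<open>s > 0\<close> by (subst ennreal_mult[symmetric]) (auto simp: power2_eq_square max_def min_def abs_if)
    finally show ?thesis .
  qed
  have "emeasure Q (space Q) = (\<integral>\<^sup>+p. ennreal (K (fst p) (snd p)) \<partial>(G \<Otimes>\<^sub>M lborel))"
    unfolding Q_def space_density
    by (subst emeasure_density[OF _ sets.top]) (auto intro!: nn_integral_cong)
  also have "\<dots> = (\<integral>\<^sup>+x. \<integral>\<^sup>+t. ennreal (K x t) \<partial>lborel \<partial>G)"
    by (subst lborel.nn_integral_fst[symmetric]) auto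
  also have "\<dots> = ennreal (\<integral>x. x\<^sup>2 / s \<partial>G)"
    unfolding int_K using integrable_square \<open>s > 0\<close>
    by (intro nn_integral_eq_integral) auto
  also have "\<dots> = 1" using \<open>s > 0\<close> by (simp add: s_def)
  finally have "prob_space Q" by (rule prob_spaceI)
  then have rd: "real_distribution N"
    unfolding N_def using snd_meas by (rule prob_space.real_distribution_distr)
  have "s * (\<integral>t. f' t \<partial>N) = (\<integral>x. x * f x \<partial>G)"
    if f: "abs_continuous_fun f" "AE x in lborel. (f has_real_derivative f' x) (at x)"
      and f'N: "integrable N f'" and xf: "integrable G (\<lambda>x. x * f x)" for f f'
  proof -
    have f'm [measurable]: "f' \<in> borel_measurable borel"
      using borel_measurable_integrable[OF f'N] by (simp add: N_def)
    \<comment> \<open>As \<open>K\<close> is nonnegative, integrability of \<open>f'\<close> under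
      \<open>N\<close> turns into integrability of this product, which justifies Fubini's
      theorem.\<close>
    have int: "integrable (G \<Otimes>\<^sub>M lborel) (\<lambda>(x, t). K x t * f' t)"
    proof -
      have "integrable Q (\<lambda>p. f' (snd p))"
        using integrable_distr[OF snd_meas f'N[unfolded N_def]] by simp
      then show ?thesis
        unfolding Q_def by (subst (asm) integrable_density) (auto simp: K_nn split_def)
    qed
    have "(\<integral>t. f' t \<partial>N) = (\<integral>p. K (fst p) (snd p) * f' (snd p) \<partial>(G \<Otimes>\<^sub>M lborel))"
      unfolding N_def Q_def by (subst integral_distr) (auto simp: integral_density K_nn)
    also have "\<dots> = (\<integral>x. \<integral>t. K x t * f' t \<partial>lborel \<partial>G)"
      using P.integral_fst[OF int] by (simp add: split_def)
    also have "\<dots> = (\<integral>x. (x * f x - x * f 0) / s \<partial>G)"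
    proof (rule integral_cong_AE)
      show "AE x in G. (\<integral>t. K x t * f' t \<partial>lborel) = (x * f x - x * f 0) / s"
        using P.AE_integrable_fst[OF int]
      proof eventually_elim
        fix x assume I: "integrable lborel (\<lambda>t. K x t * f' t)"
        show "(\<integral>t. K x t * f' t \<partial>lborel) = (x * f x - x * f 0) / s"
        proof (cases "x = 0")
          case False
          \<comment> \<open>Ordering the endpoints treats both signs of \<open>x\<close> at once:
            \<open>\<bar>x\<bar> * (f b - f a)\<close> equals
            \<open>x * (f x - f 0)\<close>.\<close>
          define a b where "a = min 0 x" and "b = max 0 x"
          have Kf: "K x t * f' t = \<bar>x\<bar> / s * (indicator {a..b} t *\<^sub>R f' t)" for t
            by (simp add: K_ind a_def b_def)
          have "set_integrable lborel {a..b} f'"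
            using I False \<open>s > 0\<close> unfolding Kf set_integrable_def
            by (subst (asm) integrable_mult_left_iff) auto
          then have "(LINT t:{a..b}|lborel. f' t) = integral {a..b} f'"
            by (rule set_borel_integral_eq_integral)
          also have "\<dots> = f b - f a"
            using f by (intro integral_unique has_integral_abs_continuous)
              (auto simp: a_def b_def abs_continuous_fun_def)
          finally have "(\<integral>t. K x t * f' t \<partial>lborel) = \<bar>x\<bar> / s * (f b - f a)"
            unfolding Kf set_lebesgue_integral_def by simp
          also have "\<dots> = (x * f x - x * f 0) / s"
            by (auto simp: a_def b_def min_def max_def field_simps)
          finally show ?thesis .
        qed (simp add: K_ind)
      qed
    qed (use P.integrable_fst[OF int] xf in auto)
    \<comment> \<open>The contribution of \<open>f 0\<close> disappears because the mean is
      zero.\<close>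
    also have "\<dots> = (\<integral>x. x * f x \<partial>G) / s"
      using xf integrable_id by (simp add: mean_zero)
    finally show ?thesis using \<open>s > 0\<close> by simp
  qed
  then have "is_zero_bias G N"
    using rd by (auto simp: is_zero_bias_def dist_variance_eq s_def)
  then show ?thesis ..
qed

lemma is_zero_bias_zero_bias: "is_zero_bias G (zero_bias G)"
  unfolding zero_bias_def using is_zero_bias_exists is_zero_bias_unique by (metis theI')

lemma cdf_zero_bias: "(\<integral>x. x\<^sup>2 \<partial>G) * cdf (zero_bias G) t = (\<integral>x. x * min x t \<partial>G)"
  by (rule cdf_is_zero_bias[OF is_zero_bias_zero_bias])

end

section \<open>The symmetrised kernel and its integral over the threshold\<close>

text \<open>Near a nonzero \<open>x\<close> the function is \<open>sgn x * y\<^sup>2 / 2\<close>; at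
  0 its difference quotient is \<open>\<bar>h\<bar> / 2\<close>, which tends to 0.\<close>

lemma DERIV_mult_abs_self: "((\<lambda>x::real. x * \<bar>x\<bar> / 2) has_real_derivative \<bar>x\<bar>) (at x)"
proof (cases "x = 0")
  case True
  have "((\<lambda>h::real. \<bar>h\<bar> / 2) \<longlongrightarrow> 0) (at 0)"
    by (rule tendsto_eq_intros refl | simp)+
  then have "((\<lambda>h::real. h * \<bar>h\<bar> / 2 / h) \<longlongrightarrow> 0) (at 0)"
    by (rule Lim_transform_eventually) (auto simp: eventually_at_filter)
  then show ?thesis using True by (simp add: DERIV_def)
next
  case False
  have "((\<lambda>y. sgn x * y\<^sup>2 / 2) has_real_derivative \<bar>x\<bar>) (at x)"
    by (auto intro!: derivative_eq_intros simp: abs_sgn mult.commute)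
  then show ?thesis
    by (rule has_field_derivative_transform_within[where d = "\<bar>x\<bar>"])
      (use False in \<open>auto simp: dist_real_def sgn_if power2_eq_square abs_if split: if_splits\<close>)
qed

text \<open>The reflection sending \<open>t\<close> to \<open>m + M - t\<close> maps
  \<open>{m..M}\<close> onto itself, so this is the integral of \<open>\<bar>t\<bar>\<close>, with
  antiderivative \<open>t * \<bar>t\<bar> / 2\<close>.\<close>

lemma nn_integral_abs_reflected:
  assumes "m \<le> M"
  shows "(\<integral>\<^sup>+t. ennreal \<bar>m + M - t\<bar> * indicator {m..M} t \<partial>lborel)
    = ennreal ((M * \<bar>M\<bar> - m * \<bar>m\<bar>) / 2)"
proof -
  have "((\<lambda>t. - ((m + M - t) * \<bar>m + M - t\<bar> / 2)) has_real_derivative \<bar>m + M - t\<bar>) (at t)" for t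
  proof -
    have "((\<lambda>t. m + M - t) has_real_derivative -1) (at t)"
      by (auto intro!: derivative_eq_intros)
    from DERIV_minus[OF DERIV_chain'[OF this DERIV_mult_abs_self]] show ?thesis by simp
  qed
  then have "(\<integral>\<^sup>+t. ennreal \<bar>m + M - t\<bar> * indicator {m..M} t \<partial>lborel)
      = ennreal (- ((m + M - M) * \<bar>m + M - M\<bar> / 2) - - ((m + M - m) * \<bar>m + M - m\<bar> / 2))"
    using assms by (intro nn_integral_FTC_Icc) auto
  then show ?thesis by (simp add: field_simps)
qed

text \<open>The integrand of the symmetrised identity for
  \<open>2 * dist_variance G * (cdf (zero_bias G) t - cdf G t)\<close>, with \<open>x\<close> and
  \<open>y\<close> the values of two independent copies.\<close>

definition pair_kernel :: "real \<Rightarrow> real \<Rightarrow> real \<Rightarrow> real" where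
  "pair_kernel x y t = (x - y) * (x + y - t) * (indicator {..t} x - indicator {..t} y)"

lemma pair_kernel_commute: "pair_kernel x y t = pair_kernel y x t"
  by (simp add: pair_kernel_def algebra_simps)

text \<open>By symmetry take \<open>x \<le> y\<close>. The indicators differ exactly for
  \<open>x \<le> t < y\<close>, where the absolute value is
  \<open>(y - x) * \<bar>x + y - t\<bar>\<close>.\<close>

lemma nn_integral_abs_pair_kernel:
  "(\<integral>\<^sup>+t. ennreal \<bar>pair_kernel x y t\<bar> \<partial>lborel) = ennreal ((x - y) * (x * \<bar>x\<bar> - y * \<bar>y\<bar>) / 2)"
proof (induction x y rule: linorder_wlog)
  case (le x y)
  have "(\<integral>\<^sup>+t. ennreal \<bar>pair_kernel x y t\<bar> \<partial>lborel)
      = (\<integral>\<^sup>+t. ennreal (y - x) * (ennreal \<bar>x + y - t\<bar> * indicator {x..y} t) \<partial>lborel)"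
  proof (rule nn_integral_cong_AE)
    \<comment> \<open>At \<open>t = y\<close> both indicators are 1 and the kernel vanishes, which
      the closed interval on the right does not reflect; a single point is a null set.\<close>
    have "ennreal \<bar>pair_kernel x y t\<bar>
        = ennreal (y - x) * (ennreal \<bar>x + y - t\<bar> * indicator {x..y} t)" if "t \<noteq> y" for t
      using le that
      by (auto simp: pair_kernel_def indicator_def abs_mult ennreal_mult[symmetric])
    then show "AE t in lborel. ennreal \<bar>pair_kernel x y t\<bar>
        = ennreal (y - x) * (ennreal \<bar>x + y - t\<bar> * indicator {x..y} t)"
      using AE_lborel_singleton[of y] by (auto elim: eventually_mono)
  qed
  also have "\<dots> = ennreal (y - x) * ennreal ((y * \<bar>y\<bar> - x * \<bar>x\<bar>) / 2)"
    using le by (subst nn_integral_cmult) (auto simp: nn_integral_abs_reflected)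
  also have "\<dots> = ennreal ((x - y) * (x * \<bar>x\<bar> - y * \<bar>y\<bar>) / 2)"
    using le by (subst ennreal_mult'[symmetric]) (auto simp: algebra_simps)
  finally show ?case .
next
  case (sym x y)
  then show ?case by (simp add: pair_kernel_commute[of y x] algebra_simps)
qed

text \<open>The function \<open>u * \<bar>u\<bar>\<close> is increasing, so both factors have the
  same sign. This allows extended and real integrals of the cubic to be identified.\<close>

lemma pair_cubic_nonneg: "0 \<le> (x - y) * (x * \<bar>x\<bar> - y * \<bar>y\<bar>)" for x y :: real
proof -
  have mono: "u * \<bar>u\<bar> \<le> v * \<bar>v\<bar>" if "u \<le> v" for u v :: real
  proof -
    consider "0 \<le> u" | "u < 0" "0 \<le> v" | "v < 0" by linarith
    then show ?thesis
    proof cases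
      case 1
      then show ?thesis using that mult_mono[of u v u v] by simp
    next
      case 2
      then have "u * \<bar>u\<bar> \<le> 0" "0 \<le> v * \<bar>v\<bar>" by (simp_all add: mult_nonpos_nonneg)
      then show ?thesis by linarith
    next
      case 3
      then show ?thesis using that mult_mono[of "-v" "-u" "-v" "-u"] by simp
    qed
  qed
  show ?thesis
    using mono[of x y] mono[of y x] by (cases "x \<le> y") (auto simp: zero_le_mult_iff)
qed

section \<open>Upper bound for the L1 distance\<close>

context centered_distribution
begin

text \<open>The expanded kernel is a sum of products of a function of \<open>x\<close> and a
  function of \<open>y\<close>. The two pure terms integrate to \<open>q\<close> each, the two
  pairings of a square with an indicator to \<open>- s * c\<close> each, and a first power standing
  alone in its variable integrates to zero.\<close>

lemma cdf_zero_bias_minus_cdf: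
  shows integrable_pair_kernel: "integrable G (\<lambda>y. pair_kernel x y t)"
    and integrable_integral_pair_kernel: "integrable G (\<lambda>x. \<integral>y. pair_kernel x y t \<partial>G)"
    and integral_pair_kernel: "(\<integral>x. \<integral>y. pair_kernel x y t \<partial>G \<partial>G)
      = 2 * dist_variance G * (cdf (zero_bias G) t - cdf G t)"
proof -
  define s c where "s = (\<integral>x. x\<^sup>2 \<partial>G)" and "c = cdf G t"
  define I :: "real \<Rightarrow> real" where "I = indicator {..t}"
  define q where "q = (\<integral>x. (x\<^sup>2 - t * x) * I x \<partial>G)"
  have intI: "integrable G I" and int_I: "(\<integral>x. I x \<partial>G) = c"
    by (auto simp: I_def c_def cdf_def less_top[symmetric] intro!: integrable_real_indicator)
  have int1: "integrable G (\<lambda>x. x * I x)" and int2: "integrable G (\<lambda>x. x\<^sup>2 * I x)"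
    unfolding I_def using integrable_id integrable_square
    by (auto intro!: integrable_real_mult_indicator)
  have intq: "integrable G (\<lambda>x. (x\<^sup>2 - t * x) * I x)"
    using int1 int2 by (simp add: left_diff_distrib mult.assoc)
  have D: "pair_kernel x y t = (x\<^sup>2 - t * x) * I x - I x * y\<^sup>2 + t * I x * y
      - (x\<^sup>2 - t * x) * I y + (y\<^sup>2 - t * y) * I y" for x y
    by (simp add: pair_kernel_def I_def algebra_simps power2_eq_square)
  note ints = intI int_I int1 int2 intq integrable_id integrable_square
  show "integrable G (\<lambda>y. pair_kernel x y t)" for x
    unfolding D using ints by simp
  have inner: "(\<integral>y. pair_kernel x y t \<partial>G) = (x\<^sup>2 - t * x) * I x - s * I x - c * (x\<^sup>2 - t * x) + q" for x
    unfolding D using ints prob_space by (simp add: mean_zero s_def q_def mult.commute)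
  show "integrable G (\<lambda>x. \<integral>y. pair_kernel x y t \<partial>G)"
    unfolding inner using ints by simp
  have "(\<integral>x. \<integral>y. pair_kernel x y t \<partial>G \<partial>G) = 2 * (q - s * c)"
    unfolding inner using ints prob_space by (simp add: mean_zero s_def[symmetric] q_def[symmetric])
  \<comment> \<open>For \<open>x \<le> t\<close> the integrands agree, and beyond \<open>t\<close>
    both vanish since there \<open>min x t = t\<close>. The term \<open>t * x\<close> then drops out
    by centring.\<close>
  also have "q = (\<integral>x. x * min x t - t * x \<partial>G)"
    unfolding q_def I_def
    by (intro Bochner_Integration.integral_cong) (auto simp: indicator_def algebra_simps power2_eq_square)
  also have "\<dots> = s * cdf (zero_bias G) t"
    using integrable_mult_min integrable_id by (simp add: mean_zero cdf_zero_bias[symmetric] s_def)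
  finally show "(\<integral>x. \<integral>y. pair_kernel x y t \<partial>G \<partial>G)
      = 2 * dist_variance G * (cdf (zero_bias G) t - cdf G t)"
    by (simp add: dist_variance_eq s_def c_def algebra_simps)
qed

text \<open>Each of the two pure cubes contributes half of the absolute third moment, and every
  mixed term has a factor \<open>x\<close> or \<open>y\<close> of mean zero.\<close>

lemma nn_integral_pair_cubic:
  assumes int3: "integrable G (\<lambda>x. \<bar>x\<bar> ^ 3)"
  shows "(\<integral>\<^sup>+x. \<integral>\<^sup>+y. ennreal ((x - y) * (x * \<bar>x\<bar> - y * \<bar>y\<bar>) / 2) \<partial>G \<partial>G)
    = ennreal (abs_third_moment G)"
proof -
  define m r where "m = abs_third_moment G" and "r = (\<integral>x. x * \<bar>x\<bar> \<partial>G)"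
  have intr: "integrable G (\<lambda>x. x * \<bar>x\<bar>)"
    by (rule Bochner_Integration.integrable_bound[OF integrable_square])
      (auto simp: abs_mult power2_eq_square)
  have cubic: "(x - y) * (x * \<bar>x\<bar> - y * \<bar>y\<bar>) / 2
      = \<bar>x\<bar> ^ 3 / 2 - x * \<bar>x\<bar> / 2 * y - x / 2 * (y * \<bar>y\<bar>) + \<bar>y\<bar> ^ 3 / 2" for x y :: real
    by (auto simp: field_simps power3_eq_cube abs_if)
  note ints = int3 intr integrable_id
  have I: "integrable G (\<lambda>y. (x - y) * (x * \<bar>x\<bar> - y * \<bar>y\<bar>) / 2)" for x
    unfolding cubic using ints by simp
  have inner: "(\<integral>y. (x - y) * (x * \<bar>x\<bar> - y * \<bar>y\<bar>) / 2 \<partial>G) = \<bar>x\<bar> ^ 3 / 2 - r / 2 * x + m / 2" for x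
    unfolding cubic using ints prob_space
    by (simp add: mean_zero r_def m_def abs_third_moment_def)
  \<comment> \<open>The sign of the closed form cannot be seen termwise, so it is read off from the
    integral that it represents.\<close>
  have "0 \<le> (\<integral>y. (x - y) * (x * \<bar>x\<bar> - y * \<bar>y\<bar>) / 2 \<partial>G)" for x
    using pair_cubic_nonneg by (intro integral_nonneg_AE) auto
  then have nonneg: "0 \<le> \<bar>x\<bar> ^ 3 / 2 - r / 2 * x + m / 2" for x unfolding inner .
  have "(\<integral>\<^sup>+y. ennreal ((x - y) * (x * \<bar>x\<bar> - y * \<bar>y\<bar>) / 2) \<partial>G)
      = ennreal (\<bar>x\<bar> ^ 3 / 2 - r / 2 * x + m / 2)" for x
    unfolding inner[symmetric] using I pair_cubic_nonneg by (intro nn_integral_eq_integral) auto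
  then have "(\<integral>\<^sup>+x. \<integral>\<^sup>+y. ennreal ((x - y) * (x * \<bar>x\<bar> - y * \<bar>y\<bar>) / 2) \<partial>G \<partial>G)
      = (\<integral>\<^sup>+x. ennreal (\<bar>x\<bar> ^ 3 / 2 - r / 2 * x + m / 2) \<partial>G)"
    by simp
  also have "\<dots> = ennreal (\<integral>x. \<bar>x\<bar> ^ 3 / 2 - r / 2 * x + m / 2 \<partial>G)"
    using ints nonneg by (intro nn_integral_eq_integral) auto
  also have "(\<integral>x. \<bar>x\<bar> ^ 3 / 2 - r / 2 * x + m / 2 \<partial>G) = m"
    using ints prob_space by (simp add: mean_zero m_def abs_third_moment_def)
  finally show ?thesis by (simp add: m_def)
qed

text \<open>The triangle inequality is applied to both integrals over \<open>G\<close>; Tonelli's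
  theorem then moves the integral over \<open>t\<close> innermost, where it is known in closed
  form.\<close>

lemma L1_dist_zero_bias_le:
  assumes int3: "integrable G (\<lambda>x. \<bar>x\<bar> ^ 3)"
  shows "ennreal (2 * dist_variance G) * L1_dist (cdf (zero_bias G)) (cdf G)
    \<le> ennreal (abs_third_moment G)"
proof -
  interpret PG: pair_sigma_finite G lborel ..
  \<comment> \<open>Arbitrary measurable arguments cover every product space and order of variables
    met in the exchanges below.\<close>
  have [measurable]: "(\<lambda>p. pair_kernel (f p) (g p) (h p)) \<in> borel_measurable M"
    if [measurable]: "f \<in> borel_measurable M" "g \<in> borel_measurable M" "h \<in> borel_measurable M"
    for f g h :: "'b \<Rightarrow> real" and M
  proof -
    have "pair_kernel x y t = (x - y) * (x + y - t) *
        ((if x \<le> t then 1 else 0) - (if y \<le> t then 1 else 0))" for x y t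
      by (simp add: pair_kernel_def indicator_def)
    then show ?thesis by simp
  qed
  interpret Z: real_distribution "zero_bias G"
    using is_zero_bias_zero_bias by (simp add: is_zero_bias_def)
  have [measurable]: "cdf (zero_bias G) \<in> borel_measurable borel" "cdf G \<in> borel_measurable borel"
    by (auto intro!: borel_measurable_mono monoI cdf_nondecreasing Z.cdf_nondecreasing)
  have "ennreal (2 * dist_variance G) * L1_dist (cdf (zero_bias G)) (cdf G)
      = (\<integral>\<^sup>+t. ennreal (2 * dist_variance G) * ennreal \<bar>cdf (zero_bias G) t - cdf G t\<bar> \<partial>lborel)"
    unfolding L1_dist_def by (rule nn_integral_cmult[symmetric]) simp
  also have "\<dots> = (\<integral>\<^sup>+t. ennreal \<bar>\<integral>x. \<integral>y. pair_kernel x y t \<partial>G \<partial>G\<bar> \<partial>lborel)"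
    using second_moment_pos unfolding integral_pair_kernel
    by (intro nn_integral_cong) (simp add: dist_variance_eq abs_mult ennreal_mult)
  also have "\<dots> \<le> (\<integral>\<^sup>+t. \<integral>\<^sup>+x. \<integral>\<^sup>+y. ennreal \<bar>pair_kernel x y t\<bar> \<partial>G \<partial>G \<partial>lborel)"
  proof (rule nn_integral_mono)
    fix t
    have "ennreal \<bar>\<integral>x. \<integral>y. pair_kernel x y t \<partial>G \<partial>G\<bar>
        \<le> (\<integral>\<^sup>+x. ennreal \<bar>\<integral>y. pair_kernel x y t \<partial>G\<bar> \<partial>G)"
      using integral_norm_bound_ennreal[OF integrable_integral_pair_kernel] by simp
    also have "\<dots> \<le> (\<integral>\<^sup>+x. \<integral>\<^sup>+y. ennreal \<bar>pair_kernel x y t\<bar> \<partial>G \<partial>G)"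
      using integral_norm_bound_ennreal[OF integrable_pair_kernel]
      by (intro nn_integral_mono) simp
    finally show "ennreal \<bar>\<integral>x. \<integral>y. pair_kernel x y t \<partial>G \<partial>G\<bar>
        \<le> (\<integral>\<^sup>+x. \<integral>\<^sup>+y. ennreal \<bar>pair_kernel x y t\<bar> \<partial>G \<partial>G)" .
  qed
  \<comment> \<open>The integral over \<open>t\<close> first passes the one over \<open>x\<close>,
    then, for fixed \<open>x\<close>, the one over \<open>y\<close>.\<close>
  also have "\<dots> = (\<integral>\<^sup>+x. \<integral>\<^sup>+t. \<integral>\<^sup>+y. ennreal \<bar>pair_kernel x y t\<bar> \<partial>G \<partial>lborel \<partial>G)"
    by (rule PG.Fubini') measurable
  also have "\<dots> = (\<integral>\<^sup>+x. \<integral>\<^sup>+y. \<integral>\<^sup>+t. ennreal \<bar>pair_kernel x y t\<bar> \<partial>lborel \<partial>G \<partial>G)"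
    by (intro nn_integral_cong PG.Fubini') measurable
  also have "\<dots> = ennreal (abs_third_moment G)"
    unfolding nn_integral_abs_pair_kernel by (rule nn_integral_pair_cubic[OF int3])
  finally show ?thesis .
qed

end

lemma F_class_centered_distribution:
  assumes "0 < \<sigma>" "G \<in> F_class \<sigma>"
  shows "centered_distribution G"
proof -
  have "real_distribution G" "dist_mean G = 0" "dist_variance G = \<sigma>\<^sup>2"
    using assms(2) by (auto simp: F_class_def)
  then show ?thesis
    using assms by (auto simp: F_class_def centered_distribution_def
        centered_distribution_axioms_def dist_mean_def dist_variance_def)
qed

text \<open>Otherwise \<open>x = 0\<close> almost surely, against the positive second moment. It
  makes the division in \<open>B_functional\<close> a genuine one.\<close>

lemma (in centered_distribution) abs_third_moment_pos:
  assumes "integrable G (\<lambda>x. \<bar>x\<bar> ^ 3)"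
  shows "0 < abs_third_moment G"
proof (rule ccontr)
  assume "\<not> 0 < abs_third_moment G"
  moreover have "0 \<le> abs_third_moment G"
    unfolding abs_third_moment_def by (intro integral_nonneg_AE) auto
  ultimately have "(\<integral>x. \<bar>x\<bar> ^ 3 \<partial>G) = 0"
    unfolding abs_third_moment_def by linarith
  then have "AE x in G. \<bar>x\<bar> ^ 3 = 0"
    using assms by (subst (asm) integral_nonneg_eq_0_iff_AE) auto
  then have "AE x in G. x\<^sup>2 = 0" by eventually_elim simp
  then have "(\<integral>x. x\<^sup>2 \<partial>G) = 0" by (rule integral_eq_zero_AE)
  then show False using second_moment_pos by simp
qed

lemma B_functional_le_1:
  assumes "0 < \<sigma>" "G \<in> F_class \<sigma>"
  shows "B_functional G \<le> 1"
proof -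
  interpret centered_distribution G
    using assms by (rule F_class_centered_distribution)
  have int3: "integrable G (\<lambda>x. \<bar>x\<bar> ^ 3)" using assms by (simp add: F_class_def)
  show ?thesis
    unfolding B_functional_def
    using abs_third_moment_pos[OF int3] L1_dist_zero_bias_le[OF int3]
    by (intro divide_le_posI_ennreal) auto
qed

section \<open>Attainment by the symmetric two-point law\<close>

text \<open>The image under the identity replaces the discrete sigma-algebra of the pmf by the Borel
  one, as \<open>real_distribution\<close> demands.\<close>

definition symmetric_two_point :: "real \<Rightarrow> real measure" where
  "symmetric_two_point \<sigma> = distr (measure_pmf (pmf_of_set {\<sigma>, - \<sigma>})) borel (\<lambda>x. x)"

context
  fixes \<sigma> :: real
  assumes \<sigma>: "0 < \<sigma>"
begin

lemma integrable_symmetric_two_point: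
  fixes f :: "real \<Rightarrow> real"
  assumes [measurable]: "f \<in> borel_measurable borel"
  shows "integrable (symmetric_two_point \<sigma>) f"
  unfolding symmetric_two_point_def
  by (subst integrable_distr_eq) (auto intro!: integrable_measure_pmf_finite)

lemma integral_symmetric_two_point:
  fixes f :: "real \<Rightarrow> real"
  assumes [measurable]: "f \<in> borel_measurable borel"
  shows "(\<integral>x. f x \<partial>symmetric_two_point \<sigma>) = (f \<sigma> + f (- \<sigma>)) / 2"
  using \<sigma> unfolding symmetric_two_point_def
  by (subst integral_distr) (auto simp: integral_pmf_of_set)

lemma symmetric_two_point_in_F_class: "symmetric_two_point \<sigma> \<in> F_class \<sigma>"
proof -
  have "dist_mean (symmetric_two_point \<sigma>) = 0"
    by (simp add: dist_mean_def integral_symmetric_two_point)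
  moreover have "real_distribution (symmetric_two_point \<sigma>)"
    unfolding symmetric_two_point_def by (intro prob_space.real_distribution_distr measure_pmf.prob_space_axioms) simp
  ultimately show ?thesis
    by (simp add: F_class_def dist_variance_def integrable_symmetric_two_point
        integral_symmetric_two_point)
qed

text \<open>The zero bias law is uniform on \<open>{- \<sigma>..\<sigma>}\<close>, while the
  two-point distribution function is 1/2 between the atoms. They differ there by
  \<open>t / (2 * \<sigma>)\<close>, whose absolute value integrates to
  \<open>\<sigma> / 2\<close>.\<close>

lemma B_functional_symmetric_two_point: "B_functional (symmetric_two_point \<sigma>) = 1"
proof -
  let ?G = "symmetric_two_point \<sigma>"
  interpret centered_distribution ?G
    using \<sigma> symmetric_two_point_in_F_class by (rule F_class_centered_distribution)
  have var: "(\<integral>x. x\<^sup>2 \<partial>?G) = \<sigma>\<^sup>2" by (simp add: integral_symmetric_two_point)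
  have third: "abs_third_moment ?G = \<sigma> ^ 3"
    using \<sigma> by (simp add: abs_third_moment_def integral_symmetric_two_point)
  have cdf_eq: "cdf ?G t = (indicator {..t} \<sigma> + indicator {..t} (- \<sigma>)) / 2" for t
    using integral_symmetric_two_point[of "indicator {..t}"] by (simp add: cdf_def)
  have zb: "cdf (zero_bias ?G) t = (\<sigma> * min \<sigma> t - \<sigma> * min (- \<sigma>) t) / (2 * \<sigma>\<^sup>2)" for t
    using cdf_zero_bias[of t] \<sigma> by (simp add: var integral_symmetric_two_point field_simps)
  \<comment> \<open>The sum \<open>- \<sigma> + \<sigma>\<close> is kept so that
    \<open>nn_integral_abs_reflected\<close> applies with \<open>m = - \<sigma>\<close> and
    \<open>M = \<sigma>\<close>.\<close>
  have "L1_dist (cdf (zero_bias ?G)) (cdf ?G)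
      = (\<integral>\<^sup>+t. ennreal (1 / (2 * \<sigma>)) * (ennreal \<bar>- \<sigma> + \<sigma> - t\<bar> * indicator {- \<sigma>..\<sigma>} t) \<partial>lborel)"
    unfolding L1_dist_def
  proof (rule nn_integral_cong_AE)
    \<comment> \<open>At \<open>t = \<sigma>\<close> both distribution functions are 1, whereas the
      closed interval gives 1/2 on the right.\<close>
    have "ennreal \<bar>cdf (zero_bias ?G) t - cdf ?G t\<bar>
        = ennreal (1 / (2 * \<sigma>)) * (ennreal \<bar>- \<sigma> + \<sigma> - t\<bar> * indicator {- \<sigma>..\<sigma>} t)"
      if "t \<noteq> \<sigma>" for t
    proof -
      consider "t < - \<sigma>" | "- \<sigma> \<le> t" "t < \<sigma>" | "\<sigma> < t" using \<open>t \<noteq> \<sigma>\<close> by linarith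
      then show ?thesis
      proof cases
        case 1
        then show ?thesis using \<sigma> by (simp add: zb cdf_eq min_def)
      next
        case 2
        then have "cdf (zero_bias ?G) t - cdf ?G t = t / (2 * \<sigma>)"
          using \<sigma> by (simp add: zb cdf_eq min_def field_simps power2_eq_square)
        then show ?thesis using 2 \<sigma> by (simp add: ennreal_mult[symmetric] abs_divide)
      next
        case 3
        then show ?thesis using \<sigma> by (simp add: zb cdf_eq min_def power2_eq_square)
      qed
    qed
    then show "AE t in lborel. ennreal \<bar>cdf (zero_bias ?G) t - cdf ?G t\<bar>
        = ennreal (1 / (2 * \<sigma>)) * (ennreal \<bar>- \<sigma> + \<sigma> - t\<bar> * indicator {- \<sigma>..\<sigma>} t)"
      using AE_lborel_singleton[of \<sigma>] by (auto elim: eventually_mono)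
  qed
  also have "\<dots> = ennreal (1 / (2 * \<sigma>)) * (\<integral>\<^sup>+t. ennreal \<bar>- \<sigma> + \<sigma> - t\<bar> * indicator {- \<sigma>..\<sigma>} t \<partial>lborel)"
    by (rule nn_integral_cmult) simp
  also have "\<dots> = ennreal (1 / (2 * \<sigma>)) * ennreal (\<sigma>\<^sup>2)"
    using \<sigma> by (subst nn_integral_abs_reflected) (auto simp: power2_eq_square)
  also have "\<dots> = ennreal (\<sigma> / 2)"
    using \<sigma> by (simp add: ennreal_mult[symmetric] power2_eq_square)
  finally have L1: "L1_dist (cdf (zero_bias ?G)) (cdf ?G) = ennreal (\<sigma> / 2)" .
  show ?thesis
    using \<sigma> unfolding B_functional_def L1 third dist_variance_eq var
    by (simp add: ennreal_mult[symmetric] power2_eq_square power3_eq_cube divide_ennreal)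
qed

end

theorem lemma1p1:
  fixes \<sigma> :: real
  assumes "0 < \<sigma>"
  shows "B_collection (F_class \<sigma>) = 1"
  unfolding B_collection_def
proof (rule antisym)
  show "(SUP G\<in>F_class \<sigma>. B_functional G) \<le> 1"
    using assms by (intro SUP_least B_functional_le_1)
  show "1 \<le> (SUP G\<in>F_class \<sigma>. B_functional G)"
    using assms by (intro SUP_upper2[OF symmetric_two_point_in_F_class])
      (simp_all add: B_functional_symmetric_two_point)
qed

end
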